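(* Let $X$ be a real Hilbert space and let $A,B$ be nonempty closed convex subsets of $X$. Let $g:=P_{\overline{B-A}}0$ and $E:=A\cap(B-g)$. Let $\lambda,\mu\in(0,2]$ and $\alpha\in(0,1+\widehat\beta)$, where $\widehat\beta:=\big(\frac{\lambda}{2-\lambda}+\frac{\mu}{2-\mu}\big)^{-1}$ (with $\widehat\beta:=0$ if $\lambda=2$ or $\mu=2$). Suppose that $E\neq\varnothing$ when $\min\{\lambda,\mu\}<2$, and $A\cap B\neq\varnothing$ when $\lambda=\mu=2$. Let $T_{\lambda,\mu}^\alpha:=(1-\alpha)\mathrm{Id}+\alpha P_B^\mu P_A^\lambda$. Then every sequence $(x_n)_{n\in\mathbb{N}}$ generated by $x_0\in X$ and $x_{n+1}=T_{\lambda,\mu}^\alpha x_n$ converges weakly to a point $\overline{x}\in\operatorname{Fix}T_{\lambda,\mu}^\alpha$ with $P_A\overline{x}\in E$.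
   Context: $P_S$ is the nearest-point projector onto a nonempty closed convex set $S$, $P_S^\lambda:=(1-\lambda)\mathrm{Id}+\lambda P_S$ is the relaxed projector, $\overline{B-A}$ is the closure of $B-A=\{b-a:b\in B,a\in A\}$, and $\operatorname{Fix}T=\{x:Tx=x\}$. *)

theory Defs
  imports "HOL-Analysis.Analysis"
begin

text \<open>
  A real Hilbert space is a type of sort \<open>{real_inner, complete_space}\<close>.  The library's
  \<open>closest_point\<close> requires the class \<open>heine_borel\<close>, hence finite dimension; the projector
  below has the same defining formula without that restriction.  It is meaningful for
  nonempty closed convex sets of a Hilbert space, where the nearest point exists and is unique.
\<close>

definition proj :: "'a::metric_space set \<Rightarrow> 'a \<Rightarrow> 'a" where
  "proj S x = (SOME p. p \<in> S \<and> (\<forall>y\<in>S. dist x p \<le> dist x y))"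

definition relaxed_proj :: "real \<Rightarrow> 'a::real_normed_vector set \<Rightarrow> 'a \<Rightarrow> 'a" where
  "relaxed_proj lam S x = (1 - lam) *\<^sub>R x + lam *\<^sub>R proj S x"

definition Fix :: "('a \<Rightarrow> 'a) \<Rightarrow> 'a set" where
  "Fix T = {x. T x = x}"

text \<open>The case distinction is needed because \<open>x / 0 = 0\<close> in HOL.\<close>

definition beta_hat :: "real \<Rightarrow> real \<Rightarrow> real" where
  "beta_hat lam mu =
    (if lam = 2 \<or> mu = 2 then 0 else inverse (lam / (2 - lam) + mu / (2 - mu)))"

definition gen_DR_op ::
    "'a::real_normed_vector set \<Rightarrow> 'a set \<Rightarrow> real \<Rightarrow> real \<Rightarrow> real \<Rightarrow> 'a \<Rightarrow> 'a" where
  "gen_DR_op A B lam mu alpha x =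
    (1 - alpha) *\<^sub>R x + alpha *\<^sub>R relaxed_proj mu B (relaxed_proj lam A x)"

text \<open>In a Hilbert space the functionals \<open>\<lambda>x. x \<bullet> u\<close> are all the continuous linear ones (Riesz).\<close>

definition weakly_converges_to :: "(nat \<Rightarrow> 'a::real_inner) \<Rightarrow> 'a \<Rightarrow> bool" where
  "weakly_converges_to x l \<longleftrightarrow> (\<forall>u. (\<lambda>n. x n \<bullet> u) \<longlonglongrightarrow> l \<bullet> u)"

end

theory Submission
  imports Defs
begin

text \<open>
  The composition of the two relaxed projectors satisfies
  \<open>\<parallel>Rx - Ry\<parallel>\<^sup>2 + \<beta> \<parallel>(x - Rx) - (y - Ry)\<parallel>\<^sup>2 \<le> \<parallel>x - y\<parallel>\<^sup>2\<close> with \<open>\<beta> = beta_hat lam mu\<close>, and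
  relaxing by \<open>alpha < 1 + \<beta>\<close> keeps such an inequality with a positive constant.  Hence, as soon as
  there is a fixed point, the orbit is Fejer monotone and asymptotically regular.  Weak convergence
  is obtained without weak compactness: the asymptotic center of a bounded sequence along a filter
  (the minimiser of \<open>limsup \<parallel>x\<^sub>n - z\<parallel>\<close>) is a fixed point, Fejer monotonicity makes it independent of
  the filter, and a point which is the asymptotic center along all these filters is the weak limit.
  Finally \<open>E\<close> is related to the fixed points by an explicit computation.  Unless \<open>lam = mu = 2\<close>,
  the point \<open>e + (mu / (lam + mu - lam * mu)) g\<close> is fixed for every \<open>e \<in> E\<close>, and conversely at a
  fixed point the displacement \<open>b - a\<close> between the two projections satisfies the variational
  inequality that characterises \<open>g\<close>.  If \<open>lam = mu = 2\<close>, then \<open>b = a\<close> and \<open>g = 0\<close>.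
\<close>

section \<open>Projections in Hilbert spaces\<close>

lemma norm_sq_midpoint:
  fixes y z w :: "'a::real_inner"
  shows "(norm (y - midpoint z w))\<^sup>2 = ((norm (y - z))\<^sup>2 + (norm (y - w))\<^sup>2) / 2 - (norm (z - w))\<^sup>2 / 4"
  unfolding power2_norm_eq_inner midpoint_def
  by (simp add: inner_diff_left inner_diff_right inner_add_left inner_add_right inner_commute field_simps)

text \<open>Minimizing sequences are Cauchy because the quadratic term controls the distance of two
  near-minimisers. The lemma is applied to squared distances, giving nearest points, and to squared
  asymptotic radii, giving asymptotic centers.\<close>

lemma strongly_midconvex_attains_min:
  fixes f :: "'a::{real_inner, complete_space} \<Rightarrow> real"
  assumes S: "closed S" "convex S" "S \<noteq> {}"
    and cont: "continuous_on S f" and bdd: "bdd_below (f ` S)"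
    and mid: "\<And>z w. z \<in> S \<Longrightarrow> w \<in> S \<Longrightarrow> f (midpoint z w) \<le> (f z + f w) / 2 - (norm (z - w))\<^sup>2 / 4"
  obtains c where "c \<in> S" "\<And>z. z \<in> S \<Longrightarrow> f c \<le> f z"
proof -
  define m where "m = Inf (f ` S)"
  have m_le: "m \<le> f z" if "z \<in> S" for z
    unfolding m_def using that bdd by (auto intro: cInf_lower)
  have "\<exists>z\<in>S. f z < m + 1 / real (Suc n)" for n
  proof -
    have "Inf (f ` S) < m + 1 / real (Suc n)" by (simp add: m_def)
    then show ?thesis using cInf_lessD[of "f ` S"] S(3) by auto
  qed
  then obtain z where z: "\<And>n. z n \<in> S" "\<And>n. f (z n) < m + 1 / real (Suc n)" by metis
  \<comment> \<open>The value at the midpoint is at least \<open>m\<close>, so a quarter of the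
    squared distance is at most the average excess over \<open>m\<close>.\<close>
  have gap: "(norm (z i - z j))\<^sup>2 \<le> 4 / real (Suc N)" if "i \<ge> N" "j \<ge> N" for i j N
  proof -
    have "midpoint (z i) (z j) \<in> S"
      using convexD[OF S(2) z(1)[of i] z(1)[of j], of "1/2" "1/2"]
      by (simp add: midpoint_def scaleR_right_distrib)
    then have "m \<le> (f (z i) + f (z j)) / 2 - (norm (z i - z j))\<^sup>2 / 4"
      using m_le mid[OF z(1) z(1)] order_trans by blast
    moreover have "f (z k) < m + 1 / real (Suc N)" if "k \<ge> N" for k
    proof -
      have "1 / real (Suc k) \<le> 1 / real (Suc N)" using that by (simp add: frac_le)
      then show ?thesis using z(2)[of k] by linarith
    qed
    from this[OF that(1)] this[OF that(2)]
    have "(f (z i) + f (z j)) / 2 - m \<le> 1 / real (Suc N)" by argo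
    ultimately show ?thesis by argo
  qed
  have "Cauchy z"
  proof (rule metric_CauchyI)
    fix e :: real assume "e > 0"
    then have "0 < e\<^sup>2 / 4" by simp
    then obtain N where N: "inverse (real (Suc N)) < e\<^sup>2 / 4" using reals_Archimedean by blast
    show "\<exists>M. \<forall>m\<ge>M. \<forall>n\<ge>M. dist (z m) (z n) < e"
    proof (intro exI allI impI)
      fix i j assume "N \<le> i" "N \<le> j"
      then have "(norm (z i - z j))\<^sup>2 \<le> 4 * inverse (real (Suc N))"
        using gap by (simp only: divide_inverse)
      then have "(norm (z i - z j))\<^sup>2 < e\<^sup>2" using N by linarith
      then show "dist (z i) (z j) < e"
        using \<open>e > 0\<close> by (simp add: dist_norm power2_less_imp_less)
    qed
  qed
  then obtain c where c: "z \<longlonglongrightarrow> c" using Cauchy_convergent convergent_def by blast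
  have cS: "c \<in> S" using S(1) z(1) c closed_sequentially by blast
  have "(\<lambda>n. f (z n)) \<longlonglongrightarrow> f c"
    using continuous_on_tendsto_compose[OF cont c cS] z(1) by simp
  moreover have "(\<lambda>n. m + 1 / real (Suc n)) \<longlonglongrightarrow> m"
    using tendsto_add[OF tendsto_const LIMSEQ_inverse_real_of_nat, of m] by (simp add: inverse_eq_divide)
  ultimately have "f c \<le> m" using z(2) by (meson LIMSEQ_le less_imp_le)
  then show thesis using that cS m_le order_trans by blast
qed

text \<open>Expanding the square under the obtuse-angle condition gives a Pythagorean inequality,
  which yields both minimality and uniqueness and so pins down the value of
  \<open>SOME\<close>.\<close>

lemma proj_eqI:
  fixes S :: "'a::real_inner set"
  assumes p: "p \<in> S" and le: "\<And>y. y \<in> S \<Longrightarrow> (x - p) \<bullet> (y - p) \<le> 0"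
  shows "proj S x = p"
proof -
  have key: "(norm (x - y))\<^sup>2 \<ge> (norm (x - p))\<^sup>2 + (norm (y - p))\<^sup>2" if "y \<in> S" for y
    using le[OF that] unfolding power2_norm_eq_inner
    by (simp add: inner_diff_left inner_diff_right inner_commute)
  have near: "dist x p \<le> dist x y" if "y \<in> S" for y
  proof -
    have "(norm (x - p))\<^sup>2 \<le> (norm (x - y))\<^sup>2"
      using key[OF that] zero_le_power2[of "norm (y - p)"] by linarith
    then show ?thesis unfolding dist_norm by (rule power2_le_imp_le) simp
  qed
  show ?thesis unfolding proj_def
  proof (rule some_equality)
    show "p \<in> S \<and> (\<forall>y\<in>S. dist x p \<le> dist x y)" using p near by blast
    fix q assume q: "q \<in> S \<and> (\<forall>y\<in>S. dist x q \<le> dist x y)"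
    then have "(norm (x - q))\<^sup>2 \<le> (norm (x - p))\<^sup>2" using p by (simp add: dist_norm power_mono)
    then have "(norm (q - p))\<^sup>2 \<le> 0" using key[of q] q by linarith
    then show "q = p" by simp
  qed
qed

text \<open>By the parallelogram law the squared distance to \<open>x\<close> satisfies the midpoint
  inequality with equality, so its minimum over \<open>S\<close> is attained.\<close>

lemma proj_nearest:
  fixes S :: "'a::{real_inner, complete_space} set"
  assumes "closed S" "convex S" "S \<noteq> {}"
  shows "proj S x \<in> S" "\<And>y. y \<in> S \<Longrightarrow> dist x (proj S x) \<le> dist x y"
proof -
  obtain p where p: "p \<in> S" "\<And>z. z \<in> S \<Longrightarrow> (norm (x - p))\<^sup>2 \<le> (norm (x - z))\<^sup>2"
    by (rule strongly_midconvex_attains_min[OF assms, of "\<lambda>z. (norm (x - z))\<^sup>2"])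
       (auto simp: norm_sq_midpoint intro!: continuous_intros bdd_belowI[of _ 0])
  then have "p \<in> S \<and> (\<forall>y\<in>S. dist x p \<le> dist x y)"
    by (auto simp: dist_norm intro: power2_le_imp_le)
  then have "proj S x \<in> S \<and> (\<forall>y\<in>S. dist x (proj S x) \<le> dist x y)"
    unfolding proj_def by (rule someI)
  then show "proj S x \<in> S" "\<And>y. y \<in> S \<Longrightarrow> dist x (proj S x) \<le> dist x y" by auto
qed

lemma proj_variational:
  fixes S :: "'a::{real_inner, complete_space} set"
  assumes "closed S" "convex S" "y \<in> S"
  shows "(x - proj S x) \<bullet> (y - proj S x) \<le> 0"
proof (rule any_closest_point_dot)
  have "S \<noteq> {}" using assms(3) by blast
  then show "proj S x \<in> S" "\<forall>z\<in>S. dist x (proj S x) \<le> dist x z"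
    using proj_nearest[OF assms(1,2)] by auto
qed (use assms in auto)

section \<open>Averaged operators\<close>

text \<open>For \<open>k > -1\<close> this says that \<open>T\<close> is averaged with constant \<open>1 / (1 + k)\<close>.\<close>

definition avg_op :: "real \<Rightarrow> ('a::real_inner \<Rightarrow> 'a) \<Rightarrow> bool" where
  "avg_op k T \<longleftrightarrow> (\<forall>x y. (norm (T x - T y))\<^sup>2 + k * (norm ((x - T x) - (y - T y)))\<^sup>2 \<le> (norm (x - y))\<^sup>2)"

lemma avg_opD:
  "avg_op k T \<Longrightarrow> (norm (T x - T y))\<^sup>2 + k * (norm ((x - T x) - (y - T y)))\<^sup>2 \<le> (norm (x - y))\<^sup>2"
  unfolding avg_op_def by blast

lemma avg_op_nonexpansive:
  assumes "avg_op k T" "k \<ge> 0"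
  shows "norm (T x - T y) \<le> norm (x - y)"
proof -
  have "0 \<le> k * (norm ((x - T x) - (y - T y)))\<^sup>2" using assms(2) by simp
  then have "(norm (T x - T y))\<^sup>2 \<le> (norm (x - y))\<^sup>2" using avg_opD[OF assms(1), of x y] by linarith
  then show ?thesis by (rule power2_le_imp_le) simp
qed

text \<open>Firm nonexpansiveness of the projector says \<open>e\<close> and \<open>d - e\<close>
  have nonnegative inner product, and relaxation replaces \<open>e\<close> by
  \<open>lam *\<^sub>R e\<close>. The constant is chosen so that the terms in \<open>e\<close> add
  up to twice \<open>lam * (e \<bullet> e)\<close>.\<close>

lemma avg_op_relaxed_proj:
  fixes S :: "'a::{real_inner, complete_space} set"
  assumes S: "closed S" "convex S" "S \<noteq> {}" and lam: "lam > 0"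
  shows "avg_op ((2 - lam) / lam) (relaxed_proj lam S)"
  unfolding avg_op_def
proof (intro allI)
  fix x y :: 'a
  define d where "d = x - y"
  define e where "e = (x - proj S x) - (y - proj S y)"
  have "(x - proj S x) \<bullet> (proj S y - proj S x) \<le> 0" "(y - proj S y) \<bullet> (proj S x - proj S y) \<le> 0"
    using proj_variational[OF S(1,2)] proj_nearest(1)[OF S] by blast+
  then have "e \<bullet> (d - e) \<ge> 0"
    unfolding d_def e_def by (simp add: inner_diff_left inner_diff_right inner_commute)
  then have de: "lam * (e \<bullet> d) \<ge> lam * (e \<bullet> e)" using lam by (simp add: inner_diff_right)
  have 1: "relaxed_proj lam S x - relaxed_proj lam S y = d - lam *\<^sub>R e"
    and 2: "(x - relaxed_proj lam S x) - (y - relaxed_proj lam S y) = lam *\<^sub>R e"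
    unfolding relaxed_proj_def d_def e_def by (simp_all add: algebra_simps)
  have "(norm (d - lam *\<^sub>R e))\<^sup>2 + (2 - lam) / lam * (norm (lam *\<^sub>R e))\<^sup>2
      = d \<bullet> d - 2 * (lam * (e \<bullet> d)) + lam * lam * (e \<bullet> e) + (2 - lam) / lam * (lam * lam * (e \<bullet> e))"
    unfolding power2_norm_eq_inner by (simp add: inner_diff_left inner_diff_right inner_commute)
  also have "\<dots> = d \<bullet> d - 2 * (lam * (e \<bullet> d)) + 2 * (lam * (e \<bullet> e))"
    using lam by (simp add: field_simps)
  also have "\<dots> \<le> (norm d)\<^sup>2" using de by (simp add: power2_norm_eq_inner)
  finally show "(norm (relaxed_proj lam S x - relaxed_proj lam S y))\<^sup>2
      + (2 - lam) / lam * (norm ((x - relaxed_proj lam S x) - (y - relaxed_proj lam S y)))\<^sup>2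
      \<le> (norm (x - y))\<^sup>2" unfolding 1 2 d_def .
qed

text \<open>After multiplication by \<open>k + l\<close> the gap between the two sides is a perfect
  square.\<close>

lemma parallel_sum_norm_sq_le:
  fixes p q :: "'a::real_inner"
  assumes "k > 0" "l > 0"
  shows "k * l / (k + l) * (norm (p + q))\<^sup>2 \<le> k * (norm p)\<^sup>2 + l * (norm q)\<^sup>2"
proof -
  have "(k + l) * (k * (norm p)\<^sup>2 + l * (norm q)\<^sup>2) - k * l * (norm (p + q))\<^sup>2 = (norm (k *\<^sub>R p - l *\<^sub>R q))\<^sup>2"
    unfolding power2_norm_eq_inner
    by (simp add: inner_diff_left inner_diff_right inner_add_left inner_add_right inner_commute algebra_simps)
  then have "k * l * (norm (p + q))\<^sup>2 \<le> (k + l) * (k * (norm p)\<^sup>2 + l * (norm q)\<^sup>2)"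
    using zero_le_power2[of "norm (k *\<^sub>R p - l *\<^sub>R q)"] by linarith
  then show ?thesis using assms by (simp add: field_simps)
qed

text \<open>The displacement differences of \<open>S\<close> and \<open>T\<close> add up to that of
  the composition, so the two constants combine into their parallel sum.\<close>

lemma avg_op_comp:
  fixes S T :: "'a::real_inner \<Rightarrow> 'a"
  assumes S: "avg_op k S" and T: "avg_op l T" and kl: "k \<ge> 0" "l \<ge> 0"
  shows "avg_op (k * l / (k + l)) (\<lambda>x. T (S x))"
  unfolding avg_op_def
proof (intro allI)
  fix x y :: 'a
  define p where "p = (x - S x) - (y - S y)"
  define q where "q = (S x - T (S x)) - (S y - T (S y))"
  have "k * l / (k + l) * (norm (p + q))\<^sup>2 \<le> k * (norm p)\<^sup>2 + l * (norm q)\<^sup>2"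
  proof (cases "k = 0 \<or> l = 0")
    \<comment> \<open>Here the parallel sum is 0, also when \<open>k = l = 0\<close> since 0 / 0 =
      0. This is the situation where a relaxation parameter equals 2.\<close>
    case True then show ?thesis using kl by auto
  next
    case False then show ?thesis using kl by (intro parallel_sum_norm_sq_le) auto
  qed
  moreover have "(norm (T (S x) - T (S y)))\<^sup>2 + l * (norm q)\<^sup>2 + k * (norm p)\<^sup>2 \<le> (norm (x - y))\<^sup>2"
    using avg_opD[OF S, of x y] avg_opD[OF T, of "S x" "S y"] unfolding p_def q_def by linarith
  moreover have "(x - T (S x)) - (y - T (S y)) = p + q" unfolding p_def q_def by simp
  ultimately show "(norm (T (S x) - T (S y)))\<^sup>2 + k * l / (k + l) * (norm ((x - T (S x)) - (y - T (S y))))\<^sup>2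
      \<le> (norm (x - y))\<^sup>2" by simp
qed

text \<open>In terms of \<open>d\<close> and \<open>e\<close> the hypothesis reads
  \<open>(1 + k) * (e \<bullet> e) \<le> 2 * (e \<bullet> d)\<close>, and relaxation scales
  \<open>e\<close> by \<open>a\<close>. The new constant is positive exactly when
  \<open>a < 1 + k\<close>, whence the upper bound on \<open>alpha\<close>.\<close>

lemma avg_op_relax:
  fixes R :: "'a::real_inner \<Rightarrow> 'a"
  assumes R: "avg_op k R" and a: "a > 0"
  shows "avg_op ((1 + k - a) / a) (\<lambda>x. (1 - a) *\<^sub>R x + a *\<^sub>R R x)"
  unfolding avg_op_def
proof (intro allI)
  fix x y :: 'a
  define d where "d = x - y"
  define e where "e = (x - R x) - (y - R y)"
  let ?T = "\<lambda>x. (1 - a) *\<^sub>R x + a *\<^sub>R R x"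
  have 1: "?T x - ?T y = d - a *\<^sub>R e" and 2: "(x - ?T x) - (y - ?T y) = a *\<^sub>R e"
    and 3: "R x - R y = d - e"
    unfolding d_def e_def by (simp_all add: algebra_simps)
  have "(norm (d - e))\<^sup>2 + k * (norm e)\<^sup>2 \<le> (norm d)\<^sup>2"
    using avg_opD[OF R, of x y] unfolding 3 by (simp add: d_def e_def)
  then have "(1 + k) * (e \<bullet> e) \<le> 2 * (e \<bullet> d)"
    unfolding power2_norm_eq_inner by (simp add: inner_diff_left inner_diff_right inner_commute algebra_simps)
  then have *: "a * ((1 + k) * (e \<bullet> e)) \<le> a * (2 * (e \<bullet> d))" using a by simp
  have "(norm (d - a *\<^sub>R e))\<^sup>2 + (1 + k - a) / a * (norm (a *\<^sub>R e))\<^sup>2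
     = d \<bullet> d - 2 * a * (e \<bullet> d) + a * a * (e \<bullet> e) + (1 + k - a) / a * (a * a * (e \<bullet> e))"
    unfolding power2_norm_eq_inner by (simp add: inner_diff_left inner_diff_right inner_commute)
  also have "\<dots> = d \<bullet> d - a * (2 * (e \<bullet> d)) + a * ((1 + k) * (e \<bullet> e))"
    using a by (simp add: field_simps)
  also have "\<dots> \<le> (norm d)\<^sup>2" using * by (simp add: power2_norm_eq_inner)
  finally show "(norm (?T x - ?T y))\<^sup>2 + (1 + k - a) / a * (norm ((x - ?T x) - (y - ?T y)))\<^sup>2 \<le> (norm (x - y))\<^sup>2"
    unfolding 1 2 d_def .
qed

section \<open>Asymptotic centers and weak convergence\<close>

text \<open>The upper limit of \<open>norm (y n - z)\<close> along \<open>F\<close>, as a real number.\<close>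

definition asym_radius :: "'i filter \<Rightarrow> ('i \<Rightarrow> 'a::real_normed_vector) \<Rightarrow> 'a \<Rightarrow> real" where
  "asym_radius F y z = Inf {t. eventually (\<lambda>n. norm (y n - z) \<le> t) F}"

lemma eventually_norm_le_imp_nonneg:
  assumes "F \<noteq> bot" "eventually (\<lambda>n. norm (y n - z) \<le> t) F"
  shows "0 \<le> t"
  using eventually_happens'[OF assms] norm_ge_zero order_trans by blast

lemma asym_radius_le:
  assumes "F \<noteq> bot" "eventually (\<lambda>n. norm (y n - z) \<le> t) F"
  shows "asym_radius F y z \<le> t"
  unfolding asym_radius_def
  by (rule cInf_lower) (use assms eventually_norm_le_imp_nonneg in \<open>auto intro!: bdd_belowI[of _ 0]\<close>)

lemma eventually_norm_diff_bounded:
  fixes y :: "'i \<Rightarrow> 'a::real_normed_vector"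
  assumes "bounded (range y)"
  obtains t where "eventually (\<lambda>n. norm (y n - z) \<le> t) F"
proof -
  obtain M where "\<And>n. norm (y n) \<le> M" using assms unfolding bounded_iff by auto
  then have "norm (y n - z) \<le> M + norm z" for n
    by (meson add_right_mono norm_triangle_ineq4 order_trans)
  then show thesis by (intro that[of "M + norm z"] always_eventually allI)
qed

lemma eventually_norm_less_of_asym_radius:
  assumes "bounded (range y)" "asym_radius F y z < t"
  shows "eventually (\<lambda>n. norm (y n - z) < t) F"
proof -
  have "{t. eventually (\<lambda>n. norm (y n - z) \<le> t) F} \<noteq> {}"
    using eventually_norm_diff_bounded[OF assms(1), of z F] by (metis empty_Collect_eq)
  then obtain s where "eventually (\<lambda>n. norm (y n - z) \<le> s) F" "s < t"
    using cInf_lessD[OF _ assms(2)[unfolded asym_radius_def]] by auto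
  then show ?thesis by (simp add: eventually_mono)
qed

lemma asym_radius_nonneg:
  assumes "F \<noteq> bot" "bounded (range y)"
  shows "0 \<le> asym_radius F y z"
  unfolding asym_radius_def
proof (rule cInf_greatest)
  show "{t. eventually (\<lambda>n. norm (y n - z) \<le> t) F} \<noteq> {}"
    using eventually_norm_diff_bounded[OF assms(2), of z F] by (metis empty_Collect_eq)
qed (use assms(1) eventually_norm_le_imp_nonneg in auto)

lemma asym_radius_lipschitz:
  assumes "F \<noteq> bot" "bounded (range y)"
  shows "asym_radius F y z \<le> asym_radius F y w + norm (z - w)"
proof (rule field_le_epsilon)
  fix e :: real assume "e > 0"
  then have "eventually (\<lambda>n. norm (y n - w) < asym_radius F y w + e) F"
    by (intro eventually_norm_less_of_asym_radius assms) simp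
  then have "eventually (\<lambda>n. norm (y n - z) \<le> asym_radius F y w + norm (z - w) + e) F"
  proof eventually_elim
    case (elim n)
    then show ?case using norm_triangle_ineq4[of "y n - w" "z - w"] by simp
  qed
  then show "asym_radius F y z \<le> asym_radius F y w + norm (z - w) + e"
    by (rule asym_radius_le[OF assms(1)])
qed

text \<open>The midpoint identity holds for each \<open>y n\<close>; it passes to the upper limit by
  allowing a slack \<open>e\<close> in both radii and then letting \<open>e\<close> tend to 0 from
  the right.\<close>

lemma asym_radius_midpoint:
  fixes y :: "'i \<Rightarrow> 'a::real_inner"
  assumes "F \<noteq> bot" "bounded (range y)"
  shows "(asym_radius F y (midpoint z w))\<^sup>2
    \<le> ((asym_radius F y z)\<^sup>2 + (asym_radius F y w)\<^sup>2) / 2 - (norm (z - w))\<^sup>2 / 4"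
proof -
  let ?r = "asym_radius F y"
  have *: "(?r (midpoint z w))\<^sup>2 \<le> ((?r z + e)\<^sup>2 + (?r w + e)\<^sup>2) / 2 - (norm (z - w))\<^sup>2 / 4" if "e > 0" for e
  proof -
    let ?q = "((?r z + e)\<^sup>2 + (?r w + e)\<^sup>2) / 2 - (norm (z - w))\<^sup>2 / 4"
    have "eventually (\<lambda>n. norm (y n - z) < ?r z + e) F" "eventually (\<lambda>n. norm (y n - w) < ?r w + e) F"
      using that by (auto intro!: eventually_norm_less_of_asym_radius assms)
    then have ev: "eventually (\<lambda>n. (norm (y n - midpoint z w))\<^sup>2 \<le> ?q) F"
    proof eventually_elim
      case (elim n)
      then have "(norm (y n - z))\<^sup>2 \<le> (?r z + e)\<^sup>2" "(norm (y n - w))\<^sup>2 \<le> (?r w + e)\<^sup>2"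
        by (auto intro: power_mono)
      then show ?case unfolding norm_sq_midpoint by argo
    qed
    then have "?q \<ge> 0" using eventually_happens'[OF assms(1) ev] zero_le_power2 order_trans by blast
    have "eventually (\<lambda>n. norm (y n - midpoint z w) \<le> sqrt ?q) F"
      using ev by (rule eventually_mono) (rule real_le_rsqrt)
    then have "?r (midpoint z w) \<le> sqrt ?q" by (rule asym_radius_le[OF assms(1)])
    then have "(?r (midpoint z w))\<^sup>2 \<le> (sqrt ?q)\<^sup>2"
      by (intro power_mono asym_radius_nonneg assms)
    then show ?thesis using \<open>?q \<ge> 0\<close> by simp
  qed
  have "((\<lambda>e. ((?r z + e)\<^sup>2 + (?r w + e)\<^sup>2) / 2 - (norm (z - w))\<^sup>2 / 4)
      \<longlongrightarrow> ((?r z + 0)\<^sup>2 + (?r w + 0)\<^sup>2) / 2 - (norm (z - w))\<^sup>2 / 4) (at_right 0)"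
    by (intro tendsto_intros) auto
  from tendsto_lowerbound[OF this, of "(?r (midpoint z w))\<^sup>2"] show ?thesis
    using * by (simp add: eventually_at_right_less eventually_mono[OF eventually_at_right_less])
qed

text \<open>The conclusion expresses strict minimality: a point is identified with \<open>c\<close>
  as soon as its radius does not exceed that of \<open>c\<close>.\<close>

lemma asymptotic_center_exists:
  fixes y :: "'i \<Rightarrow> 'a::{real_inner, complete_space}"
  assumes "F \<noteq> bot" "bounded (range y)"
  obtains c where "\<And>z. asym_radius F y z \<le> asym_radius F y c \<Longrightarrow> z = c"
proof -
  let ?r = "asym_radius F y"
  have "1-lipschitz_on UNIV ?r"
  proof (rule lipschitz_onI)
    fix z w show "dist (?r z) (?r w) \<le> 1 * dist z w"
      using asym_radius_lipschitz[OF assms, of z w] asym_radius_lipschitz[OF assms, of w z]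
      by (simp add: dist_norm abs_le_iff norm_minus_commute)
  qed simp
  then have cont: "continuous_on UNIV ?r" by (rule lipschitz_on_continuous_on)
  obtain c where c: "\<And>z. (?r c)\<^sup>2 \<le> (?r z)\<^sup>2"
    by (rule strongly_midconvex_attains_min[of UNIV "\<lambda>z. (?r z)\<^sup>2"])
       (auto intro!: continuous_intros cont asym_radius_midpoint assms bdd_belowI[of _ 0])
  have "z = c" if "?r z \<le> ?r c" for z
  proof -
    have "(?r z)\<^sup>2 \<le> (?r c)\<^sup>2" using that by (intro power_mono asym_radius_nonneg assms)
    then have "(norm (z - c))\<^sup>2 \<le> 0"
      using asym_radius_midpoint[OF assms, of z c] c[of "midpoint z c"] by argo
    then show ?thesis by simp
  qed
  then show thesis using that by blast
qed

text \<open>Along \<open>F\<close> the points \<open>y n\<close> and \<open>T (y n)\<close> become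
  indistinguishable, so applying \<open>T\<close> to \<open>z\<close> cannot increase the radius.
  Hence an asymptotic center is fixed by \<open>T\<close>.\<close>

lemma asym_radius_nonexpansive_image:
  fixes T :: "'a::real_normed_vector \<Rightarrow> 'a"
  assumes F: "F \<noteq> bot" "bounded (range y)"
    and T: "\<And>x z. norm (T x - T z) \<le> norm (x - z)"
    and reg: "((\<lambda>n. y n - T (y n)) \<longlongrightarrow> 0) F"
  shows "asym_radius F y (T z) \<le> asym_radius F y z"
proof (rule field_le_epsilon)
  fix e :: real assume "e > 0"
  then have "eventually (\<lambda>n. norm (y n - z) < asym_radius F y z + e / 2) F"
    by (intro eventually_norm_less_of_asym_radius F) simp
  moreover have "eventually (\<lambda>n. norm (y n - T (y n)) < e / 2) F"
    using tendstoD[OF reg, of "e / 2"] \<open>e > 0\<close> by (simp add: dist_norm)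
  ultimately have "eventually (\<lambda>n. norm (y n - T z) \<le> asym_radius F y z + e) F"
  proof eventually_elim
    case (elim n)
    then show ?case
      using norm_triangle_ineq[of "y n - T (y n)" "T (y n) - T z"] T[of "y n" z] by simp
  qed
  then show "asym_radius F y (T z) \<le> asym_radius F y z + e" by (rule asym_radius_le[OF F(1)])
qed

lemma asym_radius_eq_lim:
  assumes F: "F \<noteq> bot" "bounded (range y)" and lim: "((\<lambda>n. norm (y n - z)) \<longlongrightarrow> L) F"
  shows "asym_radius F y z = L"
proof (rule antisym)
  show "asym_radius F y z \<le> L"
  proof (rule field_le_epsilon)
    fix e :: real assume "e > 0"
    then have "eventually (\<lambda>n. norm (y n - z) < L + e) F" using order_tendstoD(2)[OF lim] by simp
    then show "asym_radius F y z \<le> L + e"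
      by (intro asym_radius_le F) (auto elim: eventually_mono)
  qed
  show "L \<le> asym_radius F y z"
  proof (rule field_le_epsilon)
    fix e :: real assume "e > 0"
    then have "eventually (\<lambda>n. norm (y n - z) < asym_radius F y z + e) F"
      by (intro eventually_norm_less_of_asym_radius F) simp
    then show "L \<le> asym_radius F y z + e"
      by (intro tendsto_upperbound[OF lim _ F(1)]) (auto elim: eventually_mono)
  qed
qed

section \<open>Weak convergence of orbits of nonexpansive and averaged operators\<close>

lemma weak_convergence_nonexpansive:
  fixes x :: "nat \<Rightarrow> 'a::{real_inner, complete_space}"
  assumes T: "\<And>x z. norm (T x - T z) \<le> norm (x - z)"
    and bdd: "bounded (range x)"
    and reg: "(\<lambda>n. x n - T (x n)) \<longlonglongrightarrow> 0"
    and fejer: "\<And>p. p \<in> Fix T \<Longrightarrow> convergent (\<lambda>n. norm (x n - p))"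
  shows "\<exists>c \<in> Fix T. weakly_converges_to x c"
proof -
  have center: "\<exists>c \<in> Fix T. \<forall>z. asym_radius F x z \<le> asym_radius F x c \<longrightarrow> z = c"
    if F: "F \<noteq> bot" "F \<le> sequentially" for F
  proof -
    obtain c where c: "\<And>z. asym_radius F x z \<le> asym_radius F x c \<Longrightarrow> z = c"
      using asymptotic_center_exists[OF F(1) bdd] by blast
    have "((\<lambda>n. x n - T (x n)) \<longlongrightarrow> 0) F" using reg F(2) tendsto_mono by blast
    then have "T c = c" using c asym_radius_nonexpansive_image[OF F(1) bdd T] by blast
    then show ?thesis using c unfolding Fix_def by blast
  qed
  obtain c where cFix: "c \<in> Fix T"
    and c: "\<And>z. asym_radius sequentially x z \<le> asym_radius sequentially x c \<Longrightarrow> z = c"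
    using center[of sequentially] by auto
  \<comment> \<open>Distances to a fixed point converge, so the radius at a fixed point is the same
    along every filter finer than \<open>sequentially\<close>.\<close>
  have radius_eq: "asym_radius F x p = lim (\<lambda>n. norm (x n - p))"
    if "F \<noteq> bot" "F \<le> sequentially" "p \<in> Fix T" for F p
    using asym_radius_eq_lim[OF that(1) bdd] tendsto_mono[OF that(2)] fejer[OF that(3)]
      convergent_LIMSEQ_iff by blast
  have small: "eventually (\<lambda>n. (x n - c) \<bullet> u < e) sequentially" if e: "e > 0" for u e
  proof (rule ccontr)
    assume neg: "\<not> ?thesis"
    \<comment> \<open>\<open>F\<close> plays the role of the subsequence on which the bound fails;
      it is nontrivial because the failure is frequent.\<close>
    define F where "F = inf sequentially (principal {n. e \<le> (x n - c) \<bullet> u})"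
    have evF: "eventually P F \<longleftrightarrow> eventually (\<lambda>n. e \<le> (x n - c) \<bullet> u \<longrightarrow> P n) sequentially" for P
      unfolding F_def eventually_inf_principal by simp
    have F: "F \<noteq> bot" "F \<le> sequentially"
      using neg evF[of "\<lambda>_. False"] unfolding eventually_False by (auto simp: F_def not_le)
    obtain c' where c'Fix: "c' \<in> Fix T"
      and c': "\<And>z. asym_radius F x z \<le> asym_radius F x c' \<Longrightarrow> z = c'"
      using center[OF F] by auto
    \<comment> \<open>Both points are fixed, so their radii can be compared along either filter;
      strict minimality along one of the two filters then forces equality.\<close>
    have "c' = c"
      using c[of c'] c'[of c] radius_eq[OF F] radius_eq[of sequentially] cFix c'Fix
      by (metis linear order_refl trivial_limit_sequentially)
    have u: "u \<noteq> 0"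
    proof
      assume "u = 0"
      then show False using neg e by simp
    qed
    define L where "L = asym_radius F x c"
    \<comment> \<open>This \<open>s\<close> minimises the quadratic
      \<open>- 2 * s * e + s * s * (u \<bullet> u)\<close>, whose minimum is \<open>- d\<close>.
      Moving \<open>c\<close> by \<open>s *\<^sub>R u\<close> thus gains \<open>d\<close>, which
      absorbs the slack in \<open>L\<^sup>2 + d\<close> and contradicts strict minimality of
      \<open>c\<close>.\<close>
    define s where "s = e / (u \<bullet> u)"
    define d where "d = e * s"
    have s: "s > 0" "d > 0" "s * (u \<bullet> u) = e" using u e unfolding s_def d_def by auto
    have lim: "((\<lambda>n. norm (x n - c)) \<longlongrightarrow> L) F"
      using tendsto_mono[OF F(2)] fejer[OF cFix] radius_eq[OF F cFix] convergent_LIMSEQ_iff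
      unfolding L_def by metis
    have "eventually (\<lambda>n. (norm (x n - c))\<^sup>2 < L\<^sup>2 + d) F"
      using order_tendstoD(2)[OF tendsto_power[OF lim, of 2]] s(2) by simp
    moreover have "eventually (\<lambda>n. e \<le> (x n - c) \<bullet> u) F" using evF by simp
    ultimately have "eventually (\<lambda>n. norm (x n - (c + s *\<^sub>R u)) \<le> L) F"
    proof eventually_elim
      case (elim n)
      have "(norm (x n - (c + s *\<^sub>R u)))\<^sup>2 = (norm ((x n - c) - s *\<^sub>R u))\<^sup>2" by (simp add: algebra_simps)
      also have "\<dots> = (norm (x n - c))\<^sup>2 - 2 * (s * ((x n - c) \<bullet> u)) + s * (s * (u \<bullet> u))"
        unfolding power2_norm_eq_inner
        by (simp only: inner_diff_left[of "x n - c"] inner_diff_right[of _ "x n - c"])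
           (simp add: inner_commute)
      also have "\<dots> \<le> (norm (x n - c))\<^sup>2 - 2 * (s * e) + s * e"
        using elim(2) s by simp
      also have "\<dots> \<le> L\<^sup>2" using elim(1) by (simp add: d_def mult.commute)
      finally show ?case
        by (rule power2_le_imp_le) (simp add: L_def asym_radius_nonneg[OF F(1) bdd])
    qed
    then have "asym_radius F x (c + s *\<^sub>R u) \<le> L" by (rule asym_radius_le[OF F(1)])
    then have "c + s *\<^sub>R u = c" using c' \<open>c' = c\<close> unfolding L_def by blast
    then show False using s(1) u by simp
  qed
  have "(\<lambda>n. x n \<bullet> u) \<longlonglongrightarrow> c \<bullet> u" for u
  proof (rule tendstoI)
    fix e :: real assume e: "e > 0"
    \<comment> \<open>The one-sided bound for \<open>u\<close> and for \<open>- u\<close> gives the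
      two-sided one.\<close>
    show "eventually (\<lambda>n. dist (x n \<bullet> u) (c \<bullet> u) < e) sequentially"
      using small[OF e, of u] small[OF e, of "- u"]
      by eventually_elim (auto simp: dist_real_def inner_diff_left)
  qed
  then show ?thesis using cFix unfolding weakly_converges_to_def by blast
qed

lemma weak_convergence_averaged:
  fixes x :: "nat \<Rightarrow> 'a::{real_inner, complete_space}"
  assumes T: "avg_op k T" and k: "k > 0" and ne: "Fix T \<noteq> {}" and x: "\<And>n. x (Suc n) = T (x n)"
  shows "\<exists>c \<in> Fix T. weakly_converges_to x c"
proof (rule weak_convergence_nonexpansive)
  show nexp: "norm (T x - T z) \<le> norm (x - z)" for x z using avg_op_nonexpansive[OF T] k by simp
  have conv: "convergent (\<lambda>n. norm (x n - p))" and dec: "norm (x n - p) \<le> norm (x 0 - p)"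
    if "p \<in> Fix T" for p n
  proof -
    have *: "norm (x (Suc n) - p) \<le> norm (x n - p)" for n
      using nexp[of "x n" p] that x by (simp add: Fix_def)
    then have "decseq (\<lambda>n. norm (x n - p))" by (rule decseq_SucI)
    then show "convergent (\<lambda>n. norm (x n - p))" "norm (x n - p) \<le> norm (x 0 - p)"
      using decseq_convergent[of "\<lambda>n. norm (x n - p)" 0] decseqD[of "\<lambda>n. norm (x n - p)" 0 n]
      unfolding convergent_def by auto
  qed
  show "convergent (\<lambda>n. norm (x n - p))" if "p \<in> Fix T" for p by (rule conv[OF that])
  obtain p where p: "p \<in> Fix T" using ne by blast
  have "norm (x n) \<le> norm (x 0 - p) + norm p" for n
    using dec[OF p, of n] norm_triangle_ineq[of "x n - p" p] by simp
  then show "bounded (range x)" unfolding bounded_iff by blast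
  obtain L where L: "(\<lambda>n. norm (x n - p)) \<longlonglongrightarrow> L" using conv[OF p] convergent_def by blast
  then have L': "(\<lambda>n. norm (x (Suc n) - p)) \<longlonglongrightarrow> L" by (rule LIMSEQ_Suc)
  have "(\<lambda>n. ((norm (x n - p))\<^sup>2 - (norm (x (Suc n) - p))\<^sup>2) / k) \<longlonglongrightarrow> (L\<^sup>2 - L\<^sup>2) / k"
    using k by (intro tendsto_intros L L') simp
  then have up: "(\<lambda>n. ((norm (x n - p))\<^sup>2 - (norm (x (Suc n) - p))\<^sup>2) / k) \<longlonglongrightarrow> 0" by simp
  \<comment> \<open>The averaged inequality at the fixed point \<open>p\<close> bounds the squared
    residual by the drop of the squared distance, which tends to 0.\<close>
  have "(norm (x n - T (x n)))\<^sup>2 \<le> ((norm (x n - p))\<^sup>2 - (norm (x (Suc n) - p))\<^sup>2) / k" for n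
    using avg_opD[OF T, of "x n" p] p x k by (simp add: Fix_def field_simps)
  then have "(\<lambda>n. (norm (x n - T (x n)))\<^sup>2) \<longlonglongrightarrow> 0"
    by (intro tendsto_sandwich[OF _ _ tendsto_const up]) auto
  then have "(\<lambda>n. sqrt ((norm (x n - T (x n)))\<^sup>2)) \<longlonglongrightarrow> sqrt 0" by (rule tendsto_real_sqrt)
  then show "(\<lambda>n. x n - T (x n)) \<longlonglongrightarrow> 0" by (simp add: tendsto_norm_zero_iff)
qed

section \<open>Fixed points of the generalized Douglas--Rachford operator\<close>

lemma avg_op_gen_DR_op:
  fixes A B :: "'a::{real_inner, complete_space} set"
  assumes A: "closed A" "convex A" "A \<noteq> {}" and B: "closed B" "convex B" "B \<noteq> {}"
    and lam: "lam \<in> {0<..2}" and mu: "mu \<in> {0<..2}" and alpha: "alpha > 0"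
  shows "avg_op ((1 + beta_hat lam mu - alpha) / alpha) (gen_DR_op A B lam mu alpha)"
proof -
  let ?k = "(2 - lam) / lam" and ?l = "(2 - mu) / mu"
  \<comment> \<open>The two fractions in \<open>beta_hat\<close> are the reciprocals of the
    averagedness constants, so \<open>beta_hat\<close> is their parallel sum; if a parameter is 2,
    both sides are 0.\<close>
  have "?k * ?l / (?k + ?l) = beta_hat lam mu"
  proof (cases "lam = 2 \<or> mu = 2")
    case True then show ?thesis by (auto simp: beta_hat_def)
  next
    case False
    then have pos: "?k > 0" "?l > 0" using lam mu by auto
    have "lam / (2 - lam) = 1 / ?k" "mu / (2 - mu) = 1 / ?l" by auto
    then have "beta_hat lam mu = inverse (1 / ?k + 1 / ?l)" using False by (simp add: beta_hat_def)
    also have "1 / k + 1 / l = (k + l) / (k * l)" if "k > 0" "l > 0" for k l :: real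
      using that by (simp add: field_simps)
    from this[OF pos] have "inverse (1 / ?k + 1 / ?l) = ?k * ?l / (?k + ?l)"
      by (metis inverse_divide)
    finally show ?thesis by simp
  qed
  moreover have "avg_op (?k * ?l / (?k + ?l)) (\<lambda>x. relaxed_proj mu B (relaxed_proj lam A x))"
    using lam mu by (intro avg_op_comp avg_op_relaxed_proj A B) auto
  ultimately show ?thesis
    using avg_op_relax[OF _ alpha] unfolding gen_DR_op_def[abs_def] by metis
qed

lemma Fix_gen_DR_op:
  assumes "alpha \<noteq> 0"
  shows "x \<in> Fix (gen_DR_op A B lam mu alpha) \<longleftrightarrow> relaxed_proj mu B (relaxed_proj lam A x) = x"
proof -
  have "gen_DR_op A B lam mu alpha x - x = alpha *\<^sub>R (relaxed_proj mu B (relaxed_proj lam A x) - x)"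
    unfolding gen_DR_op_def by (simp add: algebra_simps)
  then show ?thesis using assms unfolding Fix_def
    by (metis (mono_tags) eq_iff_diff_eq_0 mem_Collect_eq scaleR_eq_0_iff)
qed

lemma relaxation_denominator_pos:
  fixes lam mu :: real
  assumes "lam \<in> {0<..2}" "mu \<in> {0<..2}" "min lam mu < 2"
  shows "lam + mu - lam * mu > 0"
proof -
  have "lam * mu \<le> lam * 2" "lam * mu \<le> 2 * mu" "lam * mu < lam * 2 \<or> lam * mu < 2 * mu"
    using assms by (auto simp: min_less_iff_disj)
  then show ?thesis by linarith
qed

text \<open>The fixed point is sought on the line through \<open>e\<close> and \<open>e + g\<close>.
  By the gap inequality, \<open>e + t *\<^sub>R g\<close> projects to \<open>e\<close> on
  \<open>A\<close> for \<open>t \<ge> 0\<close>, and \<open>e + s *\<^sub>R g\<close> to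
  \<open>e + g\<close> on \<open>B\<close> for \<open>s \<le> 1\<close>.\<close>

lemma relaxed_proj_comp_fixed_point:
  fixes A B :: "'a::real_inner set"
  assumes lm: "lam > 0" "mu > 0" "lam + mu - lam * mu > 0"
    and eA: "e \<in> A" and eB: "e + g \<in> B"
    and gap: "\<And>a b. a \<in> A \<Longrightarrow> b \<in> B \<Longrightarrow> (b - a - g) \<bullet> g \<ge> 0"
  shows "\<exists>x. relaxed_proj mu B (relaxed_proj lam A x) = x"
proof
  \<comment> \<open>On this line the composition acts as an affine map of the coordinate, and
    \<open>t\<close> solves its fixed-point equation, the third fact below.\<close>
  define t where "t = mu / (lam + mu - lam * mu)"
  have t: "t \<ge> 0" "(1 - lam) * t \<le> 1" "(1 - mu) * ((1 - lam) * t) + mu = t"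
    using lm unfolding t_def by (auto simp: field_simps)
  have PA: "proj A (e + t *\<^sub>R g) = e"
  proof (rule proj_eqI[OF eA])
    fix y assume "y \<in> A"
    then have "g \<bullet> (y - e) \<le> 0" using gap[OF _ eB, of y]
      by (simp add: inner_diff_left inner_diff_right inner_add_left inner_commute)
    then show "(e + t *\<^sub>R g - e) \<bullet> (y - e) \<le> 0" using t(1) by (simp add: mult_nonneg_nonpos)
  qed
  have PB: "proj B (e + s *\<^sub>R g) = e + g" if "s \<le> 1" for s
  proof (rule proj_eqI[OF eB])
    fix y assume "y \<in> B"
    then have "g \<bullet> (y - (e + g)) \<ge> 0" using gap[OF eA, of y]
      by (simp add: inner_diff_left inner_diff_right inner_add_right inner_commute)
    moreover have "e + s *\<^sub>R g - (e + g) = (s - 1) *\<^sub>R g" by (simp add: algebra_simps)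
    ultimately show "(e + s *\<^sub>R g - (e + g)) \<bullet> (y - (e + g)) \<le> 0"
      using that by (simp add: mult_nonpos_nonneg)
  qed
  have "relaxed_proj lam A (e + t *\<^sub>R g) = e + ((1 - lam) * t) *\<^sub>R g"
    unfolding relaxed_proj_def PA by (simp add: algebra_simps)
  moreover have "relaxed_proj mu B (e + ((1 - lam) * t) *\<^sub>R g) = e + ((1 - mu) * ((1 - lam) * t) + mu) *\<^sub>R g"
    unfolding relaxed_proj_def PB[OF t(2)] by (simp add: algebra_simps)
  ultimately show "relaxed_proj mu B (relaxed_proj lam A (e + t *\<^sub>R g)) = e + t *\<^sub>R g"
    using t(3) by simp
qed

text \<open>The fixed-point equation makes the residuals at \<open>A\<close> and \<open>B\<close>
  oppositely directed multiples of one vector, so their two obtuse-angle conditions add up to a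
  variational inequality for \<open>b - a\<close>. When both parameters are 2, the first equation
  reduces to \<open>b = a\<close>.\<close>

lemma relaxed_proj_comp_fixed_pointD:
  fixes A B :: "'a::{real_inner, complete_space} set"
  assumes A: "closed A" "convex A" "A \<noteq> {}" and B: "closed B" "convex B" "B \<noteq> {}"
    and lm: "lam > 0" "mu > 0"
    and fixpt: "relaxed_proj mu B (relaxed_proj lam A x) = x"
    and a_def: "a = proj A x" and b_def: "b = proj B (relaxed_proj lam A x)"
  shows "mu *\<^sub>R (b - a) = (lam + mu - lam * mu) *\<^sub>R (x - a)"
    and "lam + mu - lam * mu > 0 \<Longrightarrow> a' \<in> A \<Longrightarrow> b' \<in> B \<Longrightarrow> (b - a) \<bullet> ((b' - a') - (b - a)) \<ge> 0"
proof -
  define y where "y = relaxed_proj lam A x"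
  have y: "y = (1 - lam) *\<^sub>R x + lam *\<^sub>R a" unfolding y_def relaxed_proj_def a_def ..
  have x: "x = (1 - mu) *\<^sub>R y + mu *\<^sub>R b" using fixpt unfolding y_def b_def relaxed_proj_def[of mu] by simp
  have "mu *\<^sub>R (b - a) = x - (1 - mu) *\<^sub>R y - mu *\<^sub>R a" using x by (simp add: algebra_simps)
  also have "\<dots> = (lam + mu - lam * mu) *\<^sub>R (x - a)" unfolding y by (simp add: algebra_simps)
  finally show eq: "mu *\<^sub>R (b - a) = (lam + mu - lam * mu) *\<^sub>R (x - a)" .
  have "mu *\<^sub>R (y - b) = y - x" using x by (simp add: algebra_simps)
  also have "\<dots> = - (lam *\<^sub>R (x - a))" unfolding y by (simp add: algebra_simps)
  finally have yb: "mu *\<^sub>R (y - b) = - (lam *\<^sub>R (x - a))" .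
  assume pos: "lam + mu - lam * mu > 0" and ab: "a' \<in> A" "b' \<in> B"
  let ?k = "lam + mu - lam * mu"
  have 1: "(x - a) \<bullet> (a' - a) \<le> 0" unfolding a_def using proj_variational A(1,2) ab(1) by blast
  have "(y - b) \<bullet> (b' - b) \<le> 0" unfolding b_def y_def using proj_variational B(1,2) ab(2) by blast
  then have "mu * ((y - b) \<bullet> (b' - b)) \<le> 0" using lm by (simp add: mult_nonneg_nonpos)
  then have "lam * ((x - a) \<bullet> (b' - b)) \<ge> 0"
    using arg_cong[OF yb, of "\<lambda>v. v \<bullet> (b' - b)"] by simp
  then have 2: "(x - a) \<bullet> (b' - b) \<ge> 0" using lm by (simp add: zero_le_mult_iff)
  have "mu * ((b - a) \<bullet> ((b' - a') - (b - a))) = ?k * ((x - a) \<bullet> ((b' - a') - (b - a)))"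
    using arg_cong[OF eq, of "\<lambda>v. v \<bullet> ((b' - a') - (b - a))"] by simp
  also have "\<dots> = ?k * ((x - a) \<bullet> (b' - b) - (x - a) \<bullet> (a' - a))"
    by (simp add: inner_diff_right)
  also have "\<dots> \<ge> 0" using pos 1 2 by simp
  finally show "(b - a) \<bullet> ((b' - a') - (b - a)) \<ge> 0" using lm by (simp add: zero_le_mult_iff)
qed

text \<open>The variational inequality defines a closed half-space, so it extends from
  \<open>S\<close> to its closure.\<close>

lemma proj_zero_closure_eqI:
  fixes v :: "'a::real_inner"
  assumes "v \<in> S" "\<And>w. w \<in> S \<Longrightarrow> v \<bullet> (w - v) \<ge> 0"
  shows "proj (closure S) 0 = v"
proof (rule proj_eqI)
  show "v \<in> closure S" using assms(1) closure_subset by blast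
  have "closed {w. v \<bullet> (w - v) \<ge> 0}" by (intro closed_Collect_le continuous_intros)
  then have "closure S \<subseteq> {w. v \<bullet> (w - v) \<ge> 0}" using assms(2) by (intro closure_minimal) auto
  then show "(0 - v) \<bullet> (w - v) \<le> 0" if "w \<in> closure S" for w using that by auto
qed

section \<open>Convergence of the generalized Douglas-Rachford iteration\<close>

theorem theorem2p14:
  fixes A B E :: "'a::{real_inner, complete_space} set"
    and g :: 'a
    and lam mu alpha :: real
    and x :: "nat \<Rightarrow> 'a"
  assumes "A \<noteq> {}" and "closed A" and "convex A"
    and "B \<noteq> {}" and "closed B" and "convex B"
    and "g = proj (closure {b - a |a b. a \<in> A \<and> b \<in> B}) 0"
    and "E = A \<inter> {b - g |b. b \<in> B}"
    and "lam \<in> {0<..2}" and "mu \<in> {0<..2}"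
    and "alpha \<in> {0<..<1 + beta_hat lam mu}"
    and "min lam mu < 2 \<Longrightarrow> E \<noteq> {}"
    and "lam = 2 \<and> mu = 2 \<Longrightarrow> A \<inter> B \<noteq> {}"
    and "\<And>n. x (Suc n) = gen_DR_op A B lam mu alpha (x n)"
  shows "\<exists>xbar. weakly_converges_to x xbar
      \<and> xbar \<in> Fix (gen_DR_op A B lam mu alpha)
      \<and> proj A xbar \<in> E"
proof -
  let ?D = "{b - a |a b. a \<in> A \<and> b \<in> B}"
  let ?T = "gen_DR_op A B lam mu alpha"
  let ?k = "lam + mu - lam * mu"
  note A = assms(2,3,1) and B = assms(5,6,4)
  have lm: "lam > 0" "mu > 0" and al: "alpha > 0" using assms(9-11) by auto
  have T: "avg_op ((1 + beta_hat lam mu - alpha) / alpha) ?T"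
    using avg_op_gen_DR_op[OF A B assms(9,10) al] .
  have pos: "(1 + beta_hat lam mu - alpha) / alpha > 0" using assms(11) by auto
  have cases: "min lam mu < 2 \<and> ?k > 0 \<or> lam = 2 \<and> mu = 2 \<and> ?k = 0"
    using relaxation_denominator_pos[OF assms(9,10)] assms(9,10)
    by (cases "lam = 2 \<and> mu = 2") (auto simp: min_def split: if_splits)
  have g0: "g = 0" if "p \<in> A" "p \<in> B" for p
  proof -
    have "0 \<in> ?D" using that by force
    then show ?thesis unfolding assms(7) by (rule proj_zero_closure_eqI) simp
  qed
  have "Fix ?T \<noteq> {}"
    using cases
  proof
    assume c: "min lam mu < 2 \<and> ?k > 0"
    then obtain b where "b - g \<in> A" "b \<in> B" using assms(12) unfolding assms(8) by auto
    then obtain e where e: "e \<in> A" "e + g \<in> B" using that[of "b - g"] by simp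
    have "?D = (\<Union>b\<in>B. \<Union>a\<in>A. {b - a})" by blast
    then have convD: "convex (closure ?D)" using convex_differences[OF B(2) A(2)]
      by (simp only: convex_closure)
    \<comment> \<open>This is the variational inequality of the projection of 0 onto the closed
      convex set \<open>closure ?D\<close>.\<close>
    have "(b - a - g) \<bullet> g \<ge> 0" if "a \<in> A" "b \<in> B" for a b
    proof -
      have "b - a \<in> closure ?D" using that closure_subset by fast
      then have "(0 - g) \<bullet> (b - a - g) \<le> 0"
        unfolding assms(7) by (rule proj_variational[OF closed_closure convD])
      then show ?thesis by (simp add: inner_commute)
    qed
    then obtain p where "relaxed_proj mu B (relaxed_proj lam A p) = p"
      using relaxed_proj_comp_fixed_point[OF lm _ e] c by blast
    then show ?thesis using al Fix_gen_DR_op[of alpha p A B lam mu] by auto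
  next
    assume "lam = 2 \<and> mu = 2 \<and> ?k = 0"
    then obtain p where p: "p \<in> A" "p \<in> B" using assms(13) by auto
    have "proj S p = p" if "p \<in> S" for S by (rule proj_eqI) (use that in auto)
    then have "relaxed_proj mu B (relaxed_proj lam A p) = p"
      using p by (simp add: relaxed_proj_def flip: scaleR_add_left)
    then show ?thesis using al Fix_gen_DR_op[of alpha p A B lam mu] by auto
  qed
  then have "\<exists>c \<in> Fix ?T. weakly_converges_to x c"
    by (rule weak_convergence_averaged[OF T pos]) (rule assms(14))
  then obtain c where c: "c \<in> Fix ?T" "weakly_converges_to x c" by blast
  have fixpt: "relaxed_proj mu B (relaxed_proj lam A c) = c" using c(1) al by (simp add: Fix_gen_DR_op)
  define a where "a = proj A c"
  define b where "b = proj B (relaxed_proj lam A c)"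
  have ab: "a \<in> A" "b \<in> B" unfolding a_def b_def using proj_nearest(1) A B by blast+
  note fixD = relaxed_proj_comp_fixed_pointD[OF A B lm fixpt a_def b_def]
  \<comment> \<open>In the first case \<open>b - a\<close> lies in \<open>?D\<close> itself and
    satisfies the inequality characterising the projection of 0; in the second, \<open>a = b\<close>
    is a common point, which forces \<open>g = 0\<close>.\<close>
  have "b - a = g"
    using cases
  proof
    assume "min lam mu < 2 \<and> ?k > 0"
    then have "(b - a) \<bullet> (w - (b - a)) \<ge> 0" if "w \<in> ?D" for w using that fixD(2) by blast
    then show ?thesis unfolding assms(7) using ab by (intro proj_zero_closure_eqI[symmetric]) auto
  next
    assume "lam = 2 \<and> mu = 2 \<and> ?k = 0"
    then have "b = a" using fixD(1) by simp
    then show ?thesis using g0[of a] ab by simp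
  qed
  then have "a = b - g" by (simp add: algebra_simps)
  then have "a \<in> E" using ab unfolding assms(8) by blast
  then show ?thesis using c unfolding a_def by blast
qed

end
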